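(* Let $n\ge 1$ and let $\mathcal{X}=\mathcal{X}_1\times\cdots\times\mathcal{X}_n$ be a product of nonempty finite sets. Then the alphabet constrained entropic set $\Gamma^*_{n,\mathcal{X}}$ is a closed connected subset of $\mathbb{R}^{2^n-1}$.
   Context: Let $\mathcal{N}=\{1,\dots,n\}$. $\mathcal{P}$ is the set of all probability mass functions $\mathbf{p}=[p(\mathbf{x}),\mathbf{x}\in\mathcal{X}]$ on $\mathcal{X}$. For $\mathbf{p}\in\mathcal{P}$ and nonempty $\alpha\subseteq\mathcal{N}$, $\mathbf{p}(X_\alpha)$ is the marginal pmf on $\prod_{i\in\alpha}\mathcal{X}_i$. The entropy vector of $\mathbf{p}$ is $\mathbf{h}(\mathbf{p})=[h(\mathbf{p}(X_\alpha)),\ \emptyset\ne\alpha\subseteq\mathcal{N}]\in\mathbb{R}^{2^n-1}$, where $h$ is Shannon entropy (logarithm to a fixed base greater than $1$, $0\log 0=0$). The alphabet constrained entropic set is $\Gamma^*_{n,\mathcal{X}}=\{\mathbf{h}(\mathbf{p}):\mathbf{p}\in\mathcal{P}\}$. *)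

theory Defs
  imports "HOL-Probability.Probability"
begin

typedef 'n nonempty_subset = "{\<alpha> :: 'n set. \<alpha> \<noteq> {}}"
  morphisms elements_of Nonempty_Subset
  by blast

instance nonempty_subset :: (finite) finite
proof
  have "finite (range (elements_of :: 'a nonempty_subset \<Rightarrow> 'a set))"
    by simp
  then show "finite (UNIV :: 'a nonempty_subset set)"
    by (rule finite_imageD) (simp add: inj_on_def elements_of_inject)
qed

lemma CARD_nonempty_subset: "CARD('n::finite nonempty_subset) = 2 ^ CARD('n) - 1"
proof -
  have "CARD('n nonempty_subset) = card {\<alpha> :: 'n set. \<alpha> \<noteq> {}}"
    by (rule type_definition.card[OF type_definition_nonempty_subset])
  also have "{\<alpha> :: 'n set. \<alpha> \<noteq> {}} = Pow UNIV - {{}}"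
    by auto
  also have "card \<dots> = 2 ^ CARD('n) - 1"
    by (simp add: card_Pow)
  finally show ?thesis .
qed

definition pmfs_on :: "'b set \<Rightarrow> 'b pmf set" where
  "pmfs_on A = {p. set_pmf p \<subseteq> A}"

definition marginal_pmf :: "'n set \<Rightarrow> ('n \<Rightarrow> 'a) pmf \<Rightarrow> ('n \<Rightarrow> 'a) pmf" where
  "marginal_pmf \<alpha> p = map_pmf (\<lambda>x. restrict x \<alpha>) p"

text \<open>For a finite alphabet \<open>A\<close>. Since multiplication by \<open>0\<close> gives \<open>0\<close>, the
  convention \<open>0 log 0 = 0\<close> holds whatever the value of \<open>log b 0\<close>.\<close>

definition shannon_entropy :: "real \<Rightarrow> 'b set \<Rightarrow> 'b pmf \<Rightarrow> real" where
  "shannon_entropy b A p = - (\<Sum>x\<in>A. pmf p x * log b (pmf p x))"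

text \<open>On pmfs supported by \<open>A\<close> this agrees with the measure-theoretic entropy of
  the library.\<close>

lemma shannon_entropy_eq_entropy:
  assumes "finite A" "set_pmf p \<subseteq> A"
  shows "shannon_entropy b A p =
    prob_space.entropy (measure_pmf p) b (count_space UNIV) (\<lambda>x. x)"
proof -
  let ?C = "count_space UNIV :: 'a measure"
  have distr: "distr (measure_pmf p) ?C (\<lambda>x. x) = measure_pmf p"
    by (rule distr_id2) simp
  have dens: "density ?C (pmf p) = measure_pmf p"
    by (rule measure_pmf_eq_density[symmetric])
  have "density ?C (RN_deriv ?C (measure_pmf p)) = measure_pmf p"
    by (rule RN_derivI[OF _ dens]) simp
  then have "emeasure (density ?C (RN_deriv ?C (measure_pmf p))) {x} = emeasure (measure_pmf p) {x}" for x
    by simp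
  then have "RN_deriv ?C (measure_pmf p) x = ennreal (pmf p x)" for x
    by (simp add: emeasure_density emeasure_pmf_single)
  then have "entropy_density b ?C (measure_pmf p) = (\<lambda>x. log b (pmf p x))"
    by (auto simp: entropy_density_def)
  then have "KL_divergence b ?C (measure_pmf p) = (\<Sum>x\<in>A. pmf p x * log b (pmf p x))"
    using assms by (simp add: KL_divergence_def mult.commute
        integral_measure_pmf_real[OF assms(1) subsetD[OF assms(2)]])
  then show ?thesis
    by (simp add: shannon_entropy_def prob_space.entropy_def[OF prob_space_measure_pmf] distr)
qed

definition entropy_vector ::
  "real \<Rightarrow> ('n::finite \<Rightarrow> 'a set) \<Rightarrow> ('n \<Rightarrow> 'a) pmf \<Rightarrow> real ^ 'n nonempty_subset" where
  "entropy_vector b X p =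
    (\<chi> \<alpha>. shannon_entropy b (PiE (elements_of \<alpha>) X) (marginal_pmf (elements_of \<alpha>) p))"

definition constrained_entropic_set ::
  "real \<Rightarrow> ('n::finite \<Rightarrow> 'a set) \<Rightarrow> (real ^ 'n nonempty_subset) set" where
  "constrained_entropic_set b X = entropy_vector b X ` pmfs_on (PiE UNIV X)"

end

theory Submission
  imports Defs "HOL-Real_Asymp.Real_Asymp"
begin

text \<open>The entropy vector depends continuously on the pmf, because marginalisation is linear
  and \<open>t \<mapsto> t log t\<close> extends continuously to \<open>t = 0\<close>. The pmfs on a finite set form a compact
  convex set, so their image is compact and connected.\<close>

text \<open>Pmfs are represented by their mass functions, so that the product topology on functions
  applies.\<close>

definition pmf_simplex :: "'b set \<Rightarrow> ('b \<Rightarrow> real) set" where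
  "pmf_simplex A = {f. (\<forall>x. 0 \<le> f x) \<and> (\<forall>x. x \<notin> A \<longrightarrow> f x = 0) \<and> sum f A = 1}"

lemma image_pmf_pmfs_on:
  assumes "finite A"
  shows "pmf ` pmfs_on A = pmf_simplex A"
proof (intro subset_antisym subsetI)
  fix f assume "f \<in> pmf ` pmfs_on A"
  then obtain p where p: "set_pmf p \<subseteq> A" "f = pmf p"
    by (auto simp: pmfs_on_def)
  then show "f \<in> pmf_simplex A"
    using sum_pmf_eq_1[OF assms p(1)] by (auto simp: pmf_simplex_def pmf_eq_0_set_pmf)
next
  fix f assume "f \<in> pmf_simplex A"
  then have f: "\<And>x. 0 \<le> f x" "\<And>x. x \<notin> A \<Longrightarrow> f x = 0" "sum f A = 1"
    by (auto simp: pmf_simplex_def)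
  \<comment> \<open>\<open>embed_pmf f\<close> has masses \<open>f\<close> once the total mass over
    the whole type is 1; the integral collapses to a sum over \<open>A\<close> because
    \<open>f\<close> vanishes elsewhere.\<close>
  have "(\<integral>\<^sup>+ x. ennreal (f x) \<partial>count_space UNIV) = (\<Sum>x\<in>A. ennreal (f x))"
    by (rule nn_integral_count_space'[OF assms]) (auto simp: f)
  also have "\<dots> = 1"
    by (simp add: f sum_ennreal)
  finally have pmf: "pmf (embed_pmf f) x = f x" for x
    by (intro pmf_embed_pmf f)
  then have "x \<in> A" if "x \<in> set_pmf (embed_pmf f)" for x
    using f(2)[of x] that by (auto simp: set_pmf_iff)
  with pmf show "f \<in> pmf ` pmfs_on A"
    by (intro image_eqI[of _ _ "embed_pmf f"]) (auto simp: pmfs_on_def)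
qed

lemma continuous_on_coordinate:
  "continuous_on S (\<lambda>f. f i :: 'b :: topological_space)"
  by (rule continuous_on_subset[OF continuous_on_product_coordinates]) simp

text \<open>A closed condition cuts the simplex out of a product of compact sets, which is compact
  by Tychonoff. Coordinates outside \<open>A\<close> are confined to \<open>{0}\<close>, so an
  infinite index type does no harm.\<close>

lemma compact_pmf_simplex:
  assumes "finite A"
  shows "compact (pmf_simplex A)"
proof -
  let ?K = "PiE UNIV (\<lambda>x. if x \<in> A then {0..1} else {0}) :: ('a \<Rightarrow> real) set"
  have "compactin (product_topology (\<lambda>x. euclidean) UNIV) ?K"
    by (subst compactin_PiE) auto
  then have "compact ?K"
    by (simp add: euclidean_product_topology)
  moreover have "closed {f :: 'a \<Rightarrow> real. sum f A = 1}"
    by (intro closed_Collect_eq continuous_intros continuous_on_coordinate)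
  moreover have "pmf_simplex A = ?K \<inter> {f. sum f A = 1}"
  proof -
    have "f x \<le> 1" if "f \<in> pmf_simplex A" "x \<in> A" for f x
      using that assms member_le_sum[of x A f] by (auto simp: pmf_simplex_def)
    then show ?thesis
      by (auto simp: pmf_simplex_def PiE_iff split: if_splits) (metis order.refl)
  qed
  ultimately show ?thesis
    by auto
qed

text \<open>Any two points are joined by their segment, whose continuity is checked
  coordinatewise.\<close>

lemma connected_pmf_simplex: "connected (pmf_simplex A)"
proof -
  have "path_connected (pmf_simplex A)"
    unfolding path_connected_def
  proof (intro ballI)
    fix f g assume f: "f \<in> pmf_simplex A" and g: "g \<in> pmf_simplex A"
    let ?h = "\<lambda>t x. (1 - t) * f x + t * g x"
    have "path ?h"
      unfolding path_def
      by (intro continuous_on_coordinatewise_then_product continuous_intros)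
    moreover have "path_image ?h \<subseteq> pmf_simplex A"
      using f g unfolding path_image_def pmf_simplex_def
      by (auto simp: sum.distrib simp flip: sum_distrib_left)
    ultimately show "\<exists>h. path h \<and> path_image h \<subseteq> pmf_simplex A \<and> pathstart h = f \<and> pathfinish h = g"
      by (intro exI[of _ ?h]) (auto simp: pathstart_def pathfinish_def)
  qed
  then show ?thesis
    by (rule path_connected_imp_connected)
qed

text \<open>Only \<open>t = 0\<close> is delicate: there the factor \<open>t\<close> makes the value
  0, which is also the limit of \<open>t * ln t\<close> from the right.\<close>

lemma continuous_on_mult_log:
  "continuous_on {0..} (\<lambda>t. t * log b t :: real)"
proof -
  have "((\<lambda>t. t * ln t :: real) \<longlongrightarrow> 0) (at_right 0)"
    by real_asymp
  then have "continuous (at t within {0..}) (\<lambda>t. t * ln t :: real)" if "t \<ge> 0" for t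
    using that by (cases "t = 0")
      (auto simp: continuous_within at_within_Ici_at_right intro!: tendsto_intros)
  then have "continuous_on {0..} (\<lambda>t. t * ln t * (1 / ln b) :: real)"
    by (intro continuous_on_mult_right) (simp add: continuous_on_eq_continuous_within)
  then show ?thesis
    by (simp add: log_def)
qed

text \<open>Each mass of the image is a finite sum over a fibre, hence linear in the masses of
  \<open>p\<close>.\<close>

lemma pmf_map_eq_sum:
  assumes "finite A" "set_pmf p \<subseteq> A"
  shows "pmf (map_pmf g p) y = (\<Sum>x\<in>{x\<in>A. g x = y}. pmf p x)"
proof -
  have "pmf (map_pmf g p) y = measure p (g -` {y} \<inter> set_pmf p)"
    by (simp add: pmf_map measure_Int_set_pmf)
  \<comment> \<open>Passing through the support replaces the possibly infinite preimage by a finite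
    fibre inside \<open>A\<close>.\<close>
  also have "g -` {y} \<inter> set_pmf p = {x\<in>A. g x = y} \<inter> set_pmf p"
    using assms by auto
  also have "measure p \<dots> = measure p {x\<in>A. g x = y}"
    by (rule measure_Int_set_pmf)
  finally show ?thesis
    using assms by (simp add: measure_measure_pmf_finite)
qed

text \<open>This extends the entropy vector to arbitrary real functions, with marginals written as
  fibre sums, so that continuity can be stated in the function space.\<close>

definition entropy_map ::
  "real \<Rightarrow> ('n::finite \<Rightarrow> 'a set) \<Rightarrow> (('n \<Rightarrow> 'a) \<Rightarrow> real) \<Rightarrow> real ^ 'n nonempty_subset" where
  "entropy_map b X f = (\<chi> \<alpha>. - (\<Sum>y\<in>PiE (elements_of \<alpha>) X.
     (\<lambda>t. t * log b t) (\<Sum>x\<in>{x\<in>PiE UNIV X. restrict x (elements_of \<alpha>) = y}. f x)))"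

lemma entropy_vector_eq_entropy_map:
  assumes "finite (PiE UNIV X)" "p \<in> pmfs_on (PiE UNIV X)"
  shows "entropy_vector b X p = entropy_map b X (pmf p)"
  using assms
  by (simp add: entropy_vector_def entropy_map_def shannon_entropy_def marginal_pmf_def
      pmfs_on_def pmf_map_eq_sum)

text \<open>On the simplex the fibre sums are nonnegative, so they stay in \<open>{0..}\<close>,
  where \<open>t * log b t\<close> is continuous.\<close>

lemma continuous_on_entropy_map: "continuous_on (pmf_simplex A) (entropy_map b X)"
  unfolding entropy_map_def
  by (intro continuous_on_vec_lambda continuous_on_minus continuous_on_sum
      continuous_on_compose2[OF continuous_on_mult_log])
    (auto intro!: continuous_on_sum continuous_on_coordinate sum_nonneg simp: pmf_simplex_def)

theorem proposition1:
  fixes b :: real and X :: "'n::finite \<Rightarrow> 'a set"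
  assumes "1 < b"
    and "\<And>i. finite (X i)"
    and "\<And>i. X i \<noteq> {}"
  shows "closed (constrained_entropic_set b X) \<and> connected (constrained_entropic_set b X)"
proof -
  have fin: "finite (PiE UNIV X)"
    using assms(2) by (intro finite_PiE) auto
  have "constrained_entropic_set b X = entropy_map b X ` pmf ` pmfs_on (PiE UNIV X)"
    unfolding constrained_entropic_set_def image_image
    by (intro image_cong refl entropy_vector_eq_entropy_map fin)
  also have "\<dots> = entropy_map b X ` pmf_simplex (PiE UNIV X)"
    by (simp only: image_pmf_pmfs_on[OF fin])
  finally show ?thesis
    using compact_continuous_image[OF continuous_on_entropy_map compact_pmf_simplex[OF fin]]
      connected_continuous_image[OF continuous_on_entropy_map connected_pmf_simplex]
    by (auto intro: compact_imp_closed)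
qed

end
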